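(* Let $X$ be a separable Fréchet space and let $T$ be a quasi-rigid continuous linear operator on $X$. Then $$\Omega(T)\subset\overline{\bigcup_{n\in\mathbb{N}}L_T^n(A)}^{\,\mathrm{SOT}}$$ for every open set $A\subset(\mathcal{L}(X),\mathrm{SOT})$ that contains a surjective operator belonging to $\Omega(T)$.
   Context: $\mathcal{L}(X)$ is the space of continuous linear operators on $X$; SOT is the strong operator topology (pointwise convergence) on $\mathcal{L}(X)$. For $T\in\mathcal{L}(X)$, $L_T:\mathcal{L}(X)\to\mathcal{L}(X)$ is the left-multiplication operator $L_T(S)=TS$. $\Omega(T)$ is the set of all $h\in\mathcal{L}(X)$ for which there is a strictly increasing sequence of positive integers $(\omega_n)_n$ such that $\{x\in X: T^{\omega_n}x\to h(x)\}$ is dense in $X$. $T$ is quasi-rigid if there is a strictly increasing sequence of positive integers $(\theta_n)_n$ such that $\{x\in X: T^{\theta_n}x\to x\}$ is dense in $X$ (i.e. $\mathrm{Id}\in\Omega(T)$). *)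

theory Defs
  imports "HOL-Analysis.Analysis"
begin

text \<open>The scalar field is \<open>\<real>\<close> or \<open>\<complex>\<close>.  The norm on the class
  \<open>real_normed_field\<close> is multiplicative, so in the second case it is the usual modulus.\<close>

class real_or_complex_field = real_normed_field +
  assumes real_or_complex:
    "(\<forall>c. \<exists>a. c = a *\<^sub>R 1) \<or>
     (\<exists>j. j * j = - 1 \<and> (\<forall>c. \<exists>a b. c = a *\<^sub>R 1 + b *\<^sub>R j))"

instance real :: real_or_complex_field
  by standard simp

instance complex :: real_or_complex_field
proof
  have "\<i> * \<i> = - 1 \<and> (\<forall>c. \<exists>a b. c = a *\<^sub>R 1 + b *\<^sub>R \<i>)"
    by (auto simp: complex_eq_iff)
  then show "(\<forall>c::complex. \<exists>a. c = a *\<^sub>R 1) \<or>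
     (\<exists>j::complex. j * j = - 1 \<and> (\<forall>c. \<exists>a b. c = a *\<^sub>R 1 + b *\<^sub>R j))"
    by blast
qed

text \<open>A Frechet space is a locally convex topological vector space whose topology is induced
  by a complete translation-invariant metric.  The space is the whole type \<open>'a\<close>; its scalar
  multiplication is a parameter, so that real and complex spaces are covered together.\<close>

locale frechet_space = vector_space smul
  for smul :: "'k::real_or_complex_field \<Rightarrow> 'a::topological_ab_group_add \<Rightarrow> 'a" +
  assumes continuous_scale: "continuous_on UNIV (\<lambda>(c, x). smul c x)"
    and locally_convex:
      "\<And>U. open U \<Longrightarrow> 0 \<in> U \<Longrightarrow>
         \<exists>V. open V \<and> 0 \<in> V \<and> V \<subseteq> U \<and>
           (\<forall>x\<in>V. \<forall>y\<in>V. \<forall>t\<in>{0..1}. smul (of_real (1 - t)) x + smul (of_real t) y \<in> V)"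
    and complete_invariant_metric:
      "\<exists>d. Metric_space (UNIV :: 'a set) d \<and> (\<forall>x y z. d (x + z) (y + z) = d x y) \<and>
         Metric_space.mtopology UNIV d = euclidean \<and> Metric_space.mcomplete UNIV d"

definition operators :: "('k::field \<Rightarrow> 'a::{ab_group_add, topological_space} \<Rightarrow> 'a) \<Rightarrow> ('a \<Rightarrow> 'a) set"
  where "operators smul = {T. Vector_Spaces.linear smul smul T \<and> continuous_on UNIV T}"

definition SOT :: "('k::field \<Rightarrow> 'a::{ab_group_add, topological_space} \<Rightarrow> 'a) \<Rightarrow> ('a \<Rightarrow> 'a) topology"
  where "SOT smul = subtopology (product_topology (\<lambda>_. euclidean) UNIV) (operators smul)"

definition left_mult :: "('a \<Rightarrow> 'a) \<Rightarrow> ('a \<Rightarrow> 'a) \<Rightarrow> ('a \<Rightarrow> 'a)"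
  where "left_mult T S = T \<circ> S"

definition Omega :: "('k::field \<Rightarrow> 'a::{ab_group_add, topological_space} \<Rightarrow> 'a) \<Rightarrow> ('a \<Rightarrow> 'a) \<Rightarrow> ('a \<Rightarrow> 'a) set"
  where "Omega smul T =
    {h \<in> operators smul. \<exists>\<omega>::nat \<Rightarrow> nat. strict_mono \<omega> \<and> (\<forall>n. 0 < \<omega> n) \<and>
       closure {x. (\<lambda>n. (T ^^ \<omega> n) x) \<longlonglongrightarrow> h x} = UNIV}"

definition quasi_rigid :: "('a::topological_space \<Rightarrow> 'a) \<Rightarrow> bool"
  where "quasi_rigid T \<longleftrightarrow>
    (\<exists>\<theta>::nat \<Rightarrow> nat. strict_mono \<theta> \<and> (\<forall>n. 0 < \<theta> n) \<and>
       closure {x. (\<lambda>n. (T ^^ \<theta> n) x) \<longlonglongrightarrow> x} = UNIV)"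

end

theory Submission
  imports Defs
begin

text \<open>
  Fix \<open>h\<close> in \<open>Omega smul T\<close>, an operator \<open>S\<close> in both \<open>A\<close> and \<open>Omega smul T\<close>, and a strong-operator
  neighbourhood of \<open>h\<close>.  A continuous linear operator \<open>R\<close> in \<open>A\<close> and an \<open>n \<ge> 1\<close> are
  wanted for which \<open>T ^^ n \<circ> R\<close> lies in that neighbourhood.  This neighbourhood of
  \<open>h\<close>, and some neighbourhood of \<open>S\<close> contained in \<open>A\<close>, constrain the values of an operator at
  finitely many points only, and hence at a finite linearly independent set \<open>B\<close>.

  The dynamical half of the argument forgets linearity.  On the space of \<^emph>\<open>all\<close> functions
  \<open>'a \<Rightarrow> 'a\<close> with pointwise convergence, \<open>T\<close>, \<open>S\<close> and \<open>h\<close> act by left composition, and the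
  three dense convergence sets (for \<open>S\<close>, for \<open>h\<close> and for the identity) stay dense because a
  product of dense sets is dense.  From the identity function, a point \<open>y\<close> near it is chosen
  with \<open>T ^^ a\<close> sending \<open>y\<close> close to \<open>S\<close>, with \<open>T ^^ c\<close> sending a whole neighbourhood of \<open>y\<close>
  close to \<open>h\<close>, and with \<open>T ^^ b\<close> returning \<open>y\<close> to that neighbourhood for some \<open>b > a\<close>.  Then
  \<open>z = T ^^ a \<circ> y\<close> is close to \<open>S\<close> and \<open>T ^^ (c + b - a) \<circ> z\<close> is close to \<open>h\<close>; this is
  lemma \<open>dense_limits_transfer\<close>.

  The linear half replaces the function \<open>z\<close> by an operator that agrees with it on \<open>B\<close>.  The
  Hahn-Banach theorem gives continuous functionals \<open>\<phi> b\<close> dual to \<open>B\<close> (lemma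
  \<open>exists_dual_functionals\<close>), and
  \<open>R x = (\<Sum>b\<in>B. smul (\<phi> b x) (z b))\<close> is such an operator.  Hahn-Banach itself is
  obtained from Zorn's lemma, as the fact that a minimal sublinear functional is linear.
\<close>

section \<open>Sublinear functionals and the Hahn-Banach theorem\<close>

locale real_vector_space = vector_space s
  for s :: "real \<Rightarrow> 'a::ab_group_add \<Rightarrow> 'a"
begin

text \<open>Subadditive and positively homogeneous real functionals.  Only one inequality of
  homogeneity is required; the other one and \<open>q 0 = 0\<close> follow (lemmas \<open>sublinear_zero\<close> and \<open>sublinear_scale\<close>).\<close>

definition sublinear :: "('a \<Rightarrow> real) \<Rightarrow> bool"
  where "sublinear q \<longleftrightarrow>
    (\<forall>x y. q (x + y) \<le> q x + q y) \<and> (\<forall>t>0. \<forall>x. q (s t x) \<le> t * q x)"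

lemma sublinear_add: "sublinear q \<Longrightarrow> q (x + y) \<le> q x + q y"
  by (simp add: sublinear_def)

lemma sublinear_zero:
  assumes "sublinear q"
  shows "q 0 = 0"
proof -
  have "q (s 2 0) \<le> 2 * q 0" "q (s (1/2) 0) \<le> (1/2) * q 0"
    using assms unfolding sublinear_def
    by (metis zero_less_numeral, metis half_gt_zero_iff zero_less_one)
  then show ?thesis by simp
qed

lemma sublinear_scale:
  assumes "sublinear q" "0 \<le> t"
  shows "q (s t x) = t * q x"
proof (cases "t = 0")
  case True
  then show ?thesis using sublinear_zero[OF assms(1)] by simp
next
  case False
  with assms(2) have t: "t > 0" by simp
  have "q (s (inverse t) (s t x)) \<le> inverse t * q (s t x)"
    using assms(1) t unfolding sublinear_def by (metis positive_imp_inverse_positive)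
  then have "t * q x \<le> q (s t x)"
    using t by (simp add: field_simps)
  moreover have "q (s t x) \<le> t * q x"
    using assms(1) t by (simp add: sublinear_def)
  ultimately show ?thesis by simp
qed

lemma sublinear_minus:
  assumes "sublinear q"
  shows "- q (- x) \<le> q x"
  using sublinear_add[OF assms, of x "- x"] sublinear_zero[OF assms] by simp

text \<open>The index family need not consist of sublinear functionals.  This serves both the infimum
  over a chain and the infimum over the multiples of a vector in \<open>sublinear_reduce\<close>.\<close>

lemma sublinear_INF:
  fixes g :: "'i \<Rightarrow> 'a \<Rightarrow> real"
  assumes ne: "I \<noteq> {}"
    and bdd: "\<And>x. bdd_below ((\<lambda>i. g i x) ` I)"
    and add: "\<And>i j x y. i \<in> I \<Longrightarrow> j \<in> I \<Longrightarrow> \<exists>k\<in>I. g k (x + y) \<le> g i x + g j y"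
    and scale: "\<And>i t x. i \<in> I \<Longrightarrow> 0 < t \<Longrightarrow> \<exists>k\<in>I. g k (s t x) \<le> t * g i x"
  shows "sublinear (\<lambda>x. INF i\<in>I. g i x)"
  unfolding sublinear_def
proof (intro conjI allI impI)
  fix x y
  have le: "(INF i\<in>I. g i (x + y)) \<le> g i x + g j y" if "i \<in> I" "j \<in> I" for i j
    using add[OF that, of x y] cINF_lower[OF bdd] by (meson order_trans)
  have "(INF i\<in>I. g i (x + y)) - g i x \<le> (INF j\<in>I. g j y)" if "i \<in> I" for i
    using le[OF that] by (intro cINF_greatest ne) (simp add: algebra_simps)
  then have "(INF i\<in>I. g i (x + y)) - (INF j\<in>I. g j y) \<le> (INF i\<in>I. g i x)"
    by (intro cINF_greatest ne) (simp add: algebra_simps)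
  then show "(INF i\<in>I. g i (x + y)) \<le> (INF i\<in>I. g i x) + (INF i\<in>I. g i y)"
    by simp
next
  fix t :: real and x
  assume t: "0 < t"
  have "(INF i\<in>I. g i (s t x)) \<le> t * g i x" if "i \<in> I" for i
    using scale[OF that t, of x] cINF_lower[OF bdd] by (meson order_trans)
  then have "(INF i\<in>I. g i (s t x)) / t \<le> (INF i\<in>I. g i x)"
    using t by (intro cINF_greatest ne) (simp add: field_simps)
  then show "(INF i\<in>I. g i (s t x)) \<le> t * (INF i\<in>I. g i x)"
    using t by (simp add: field_simps)
qed

text \<open>Taking the infimum of \<open>q (x + t y) - t (q y)\<close> over \<open>t \<ge> 0\<close> makes the functional as small
  as possible at \<open>- y\<close>.  If \<open>q\<close> is minimal, then \<open>q' = q\<close> and the last inequality says that \<open>q\<close>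
  is superadditive.\<close>

lemma sublinear_reduce:
  assumes q: "sublinear q"
  obtains q' where "sublinear q'" "\<And>x. q' x \<le> q x" "\<And>x. q' x \<le> q (x + y) - q y"
proof -
  define g where "g t x = q (x + s t y) - t * q y" for t x
  define q' where "q' x = (INF t\<in>{0..}. g t x)" for x
  have lower: "- q (- x) \<le> g t x" if "t \<ge> 0" for t x
    using sublinear_add[OF q, of "x + s t y" "- x"] sublinear_scale[OF q that, of y]
    by (simp add: g_def)
  have bdd: "bdd_below ((\<lambda>t. g t x) ` {0..})" for x
    using lower by (intro bdd_belowI2) auto
  have "sublinear q'"
    unfolding q'_def
  proof (rule sublinear_INF)
    show "bdd_below ((\<lambda>t. g t x) ` {0..})" for x by (rule bdd)
  next
    fix i j :: real and u v
    assume "i \<in> {0..}" "j \<in> {0..}"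
    moreover have "u + v + s (i + j) y = (u + s i y) + (v + s j y)"
      by (simp add: scale_left_distrib)
    then have "g (i + j) (u + v) \<le> g i u + g j v"
      using sublinear_add[OF q, of "u + s i y" "v + s j y"]
      by (simp add: g_def algebra_simps)
    ultimately show "\<exists>k\<in>{0..}. g k (u + v) \<le> g i u + g j v"
      by (intro bexI[of _ "i + j"]) auto
  next
    fix i t :: real and u
    assume "i \<in> {0..}" "0 < t"
    moreover have "s t u + s (t * i) y = s t (u + s i y)"
      by (simp add: scale_right_distrib)
    then have "g (t * i) (s t u) = t * g i u"
      using sublinear_scale[OF q, of t "u + s i y"] \<open>0 < t\<close>
      by (simp add: g_def algebra_simps)
    ultimately show "\<exists>k\<in>{0..}. g k (s t u) \<le> t * g i u"
      by (intro bexI[of _ "t * i"]) auto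
  qed simp
  moreover have "q' x \<le> q x" for x
    using cINF_lower[OF bdd, of 0 x] by (simp add: q'_def g_def)
  moreover have "q' x \<le> q (x + y) - q y" for x
    using cINF_lower[OF bdd, of 1 x] by (simp add: q'_def g_def)
  ultimately show ?thesis by (rule that)
qed

lemma exists_minimal_sublinear:
  assumes p: "sublinear p"
  obtains q where "sublinear q" "\<And>x. q x \<le> p x"
    "\<And>r. sublinear r \<Longrightarrow> (\<And>x. r x \<le> q x) \<Longrightarrow> r = q"
proof -
  define Q where "Q = {q. sublinear q \<and> (\<forall>x. q x \<le> p x)}"
  define P where "P = (\<lambda>(f::'a \<Rightarrow> real) g. \<forall>x. g x \<le> f x)"
  have pQ: "p \<in> Q" using p by (simp add: Q_def)
  have po: "partial_order_on Q (relation_of P Q)"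
    by (rule partial_order_on_relation_ofI)
      (auto simp: P_def fun_eq_iff intro: order_trans antisym)
  have ub: "\<exists>u\<in>Q. \<forall>a\<in>C. P a u" if C: "C \<in> Chains (relation_of P Q)" for C
  proof -
    have CQ: "C \<subseteq> Q" using C by (auto simp: Chains_def relation_of_def)
    have chain: "(\<forall>x. g x \<le> f x) \<or> (\<forall>x. f x \<le> g x)" if "f \<in> C" "g \<in> C" for f g
      using C that by (auto simp: Chains_def relation_of_def P_def)
    show "\<exists>u\<in>Q. \<forall>a\<in>C. P a u"
    proof (cases "C = {}")
      case True
      then show ?thesis using pQ by auto
    next
      case ne: False
      define u where "u x = (INF q\<in>C. q x)" for x
      have lower: "- p (- x) \<le> q x" if "q \<in> C" for q x
      proof -
        have "sublinear q" "q (- x) \<le> p (- x)" using that CQ by (auto simp: Q_def)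
        then show ?thesis using sublinear_minus[of q x] by simp
      qed
      have bdd: "bdd_below ((\<lambda>q. q x) ` C)" for x
        using lower by (intro bdd_belowI2) auto
      have sub: "sublinear q" if "q \<in> C" for q using that CQ by (auto simp: Q_def)
      have "sublinear u"
        unfolding u_def
      proof (rule sublinear_INF[OF ne bdd])
        fix f g x y assume fg: "f \<in> C" "g \<in> C"
        then show "\<exists>k\<in>C. k (x + y) \<le> f x + g y"
          using chain[OF fg] sublinear_add[OF sub[OF fg(1)], of x y]
            sublinear_add[OF sub[OF fg(2)], of x y]
          by (meson add_mono order_refl order_trans)
      next
        fix f t x assume "f \<in> C" "(0::real) < t"
        then show "\<exists>k\<in>C. k (s t x) \<le> t * f x"
          using sublinear_scale[OF sub, of f t x] by (intro bexI[of _ f]) auto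
      qed
      moreover have le: "u x \<le> q x" if "q \<in> C" for q x
        using cINF_lower[OF bdd that] by (simp add: u_def)
      moreover have "u x \<le> p x" for x
        using ne le CQ by (force simp: Q_def intro: order_trans)
      ultimately show ?thesis by (auto simp: Q_def P_def)
    qed
  qed
  obtain q where q: "q \<in> Q" "\<forall>a\<in>Q. P q a \<longrightarrow> a = q"
    using predicate_Zorn[OF po ub] by auto
  have "r = q" if r: "sublinear r" "\<And>x. r x \<le> q x" for r
  proof -
    have "r x \<le> p x" for x using r(2)[of x] q(1) unfolding Q_def by (auto intro: order_trans)
    then have "r \<in> Q" using r(1) by (simp add: Q_def)
    then show ?thesis using q(2) r(2) by (auto simp: P_def)
  qed
  then show ?thesis using that q(1) by (auto simp: Q_def)
qed

text \<open>A minimal sublinear functional is additive by \<open>sublinear_reduce\<close>, hence linear.  The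
  minimal one is taken below a functional already reduced in the direction \<open>v\<close>, which forces
  the value \<open>p v\<close> at \<open>v\<close>.\<close>

lemma hahn_banach_sublinear:
  assumes p: "sublinear p"
  obtains f where "\<And>x y. f (x + y) = f x + f y" "\<And>t x. f (s t x) = t * f x"
    "\<And>x. f x \<le> p x" "f v = p v"
proof -
  obtain p' where p': "sublinear p'" "\<And>x. p' x \<le> p x" "\<And>x. p' x \<le> p (x + v) - p v"
    using sublinear_reduce[OF p, of v] by blast
  obtain f where f: "sublinear f" "\<And>x. f x \<le> p' x"
    and min: "\<And>r. sublinear r \<Longrightarrow> (\<And>x. r x \<le> f x) \<Longrightarrow> r = f"
    using exists_minimal_sublinear[OF p'(1)] by blast
  have add: "f (x + y) = f x + f y" for x y
  proof -
    obtain r where r: "sublinear r" "\<And>x. r x \<le> f x" "\<And>x. r x \<le> f (x + y) - f y"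
      using sublinear_reduce[OF f(1), of y] by blast
    have "r = f" using min r(1,2) by blast
    then show ?thesis using r(3)[of x] sublinear_add[OF f(1), of x y] by simp
  qed
  have neg: "f (- x) = - f x" for x
    using add[of x "- x"] sublinear_zero[OF f(1)] by simp
  have scale: "f (s t x) = t * f x" for t x
  proof (cases "0 \<le> t")
    case True
    then show ?thesis by (rule sublinear_scale[OF f(1)])
  next
    case False
    then have "f (s (- t) x) = - t * f x" by (intro sublinear_scale[OF f(1)]) simp
    then show ?thesis using neg[of "s t x"] by simp
  qed
  have le: "f x \<le> p x" for x using f(2)[of x] p'(2)[of x] by simp
  have "p v \<le> f v"
    using f(2)[of "- v"] p'(3)[of "- v"] neg[of v] sublinear_zero[OF p] by simp
  with le[of v] have "f v = p v" by simp
  with add scale le show ?thesis by (rule that)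
qed

text \<open>The Minkowski functional of \<open>V\<close> is the infimum of the \<open>t > 0\<close> with \<open>x\<close> in \<open>t V\<close>.\<close>

lemma exists_minkowski_functional:
  assumes absorb: "\<And>x. \<exists>t>0. s (inverse t) x \<in> V"
    and conv: "\<And>x y t. x \<in> V \<Longrightarrow> y \<in> V \<Longrightarrow> 0 \<le> t \<Longrightarrow> t \<le> 1 \<Longrightarrow> s (1 - t) x + s t y \<in> V"
    and zero: "0 \<in> V"
  obtains p where "sublinear p" "\<And>x. x \<in> V \<Longrightarrow> p x \<le> 1" "\<And>x. x \<notin> V \<Longrightarrow> 1 \<le> p x"
proof -
  define N where "N x = {t. 0 < t \<and> s (inverse t) x \<in> V}" for x
  define p where "p x = Inf (N x)" for x
  have ne: "N x \<noteq> {}" for x using absorb[of x] by (auto simp: N_def)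
  have bdd: "bdd_below (N x)" for x by (rule bdd_belowI[of _ 0]) (simp add: N_def)
  have N_add: "a + b \<in> N (x + y)" if "a \<in> N x" "b \<in> N y" for a b x y
  proof -
    have ab: "0 < a" "0 < b" using that by (auto simp: N_def)
    let ?t = "b / (a + b)"
    have t: "0 \<le> ?t" "?t \<le> 1" "(1 - ?t) * inverse a = inverse (a + b)"
      "?t * inverse b = inverse (a + b)"
      using ab by (auto simp: field_simps)
    have "s (1 - ?t) (s (inverse a) x) + s ?t (s (inverse b) y) \<in> V"
      using that t(1,2) by (intro conv) (auto simp: N_def)
    then have "s (inverse (a + b)) (x + y) \<in> V"
      unfolding scale_scale t(3,4) by (simp add: scale_right_distrib)
    then show ?thesis using ab by (simp add: N_def)
  qed
  have N_scale: "t * a \<in> N (s t x)" if "a \<in> N x" "0 < t" for a t x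
    using that by (simp add: N_def field_simps)
  have "sublinear p"
    unfolding sublinear_def
  proof (intro conjI allI impI)
    fix x y
    have le: "p (x + y) \<le> a + b" if "a \<in> N x" "b \<in> N y" for a b
      unfolding p_def using N_add[OF that] by (rule cInf_lower[OF _ bdd])
    have "p (x + y) - a \<le> p y" if "a \<in> N x" for a
      unfolding p_def[of y] using le[OF that] by (intro cInf_greatest ne) (simp add: algebra_simps)
    then have "p (x + y) - p y \<le> p x"
      unfolding p_def[of x] by (intro cInf_greatest ne) (simp add: algebra_simps)
    then show "p (x + y) \<le> p x + p y" by simp
  next
    fix t :: real and x
    assume t: "0 < t"
    have "p (s t x) \<le> t * a" if "a \<in> N x" for a
      unfolding p_def using N_scale[OF that t] by (rule cInf_lower[OF _ bdd])
    then have "p (s t x) / t \<le> p x"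
      unfolding p_def[of x] using t by (intro cInf_greatest ne) (simp add: field_simps)
    then show "p (s t x) \<le> t * p x" using t by (simp add: field_simps)
  qed
  moreover have "p x \<le> 1" if "x \<in> V" for x
    unfolding p_def using that by (intro cInf_lower bdd) (simp add: N_def)
  moreover have "1 \<le> p x" if "x \<notin> V" for x
    unfolding p_def
  proof (intro cInf_greatest ne)
    fix t assume "t \<in> N x"
    then have t: "0 < t" "s (inverse t) x \<in> V" by (auto simp: N_def)
    show "1 \<le> t"
    proof (rule ccontr)
      assume "\<not> 1 \<le> t"
      then have "s (1 - t) 0 + s t (s (inverse t) x) \<in> V"
        using t zero by (intro conv) auto
      with t(1) that show False by simp
    qed
  qed
  ultimately show ?thesis by (rule that)
qed

end

section \<open>Continuous functionals on a locally convex space\<close>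

context frechet_space
begin

lemma smul_continuous_on [continuous_intros]:
  assumes "continuous_on C f" "continuous_on C g"
  shows "continuous_on C (\<lambda>x. smul (f x) (g x))"
proof -
  have "continuous_on C ((\<lambda>(c, x). smul c x) \<circ> (\<lambda>x. (f x, g x)))"
    by (intro continuous_on_compose continuous_on_Pair assms
        continuous_on_subset[OF continuous_scale]) simp
  then show ?thesis by (simp add: o_def)
qed

lemma real_scaling: "real_vector_space (\<lambda>t. smul (of_real t))"
  by unfold_locales (simp_all add: scale_left_distrib scale_right_distrib)

text \<open>Continuous linear functionals over the scalar field of the space.\<close>

definition functional :: "('a \<Rightarrow> 'k) \<Rightarrow> bool"
  where "functional f \<longleftrightarrow> (\<forall>x y. f (x + y) = f x + f y) \<and>
    (\<forall>c x. f (smul c x) = c * f x) \<and> continuous_on UNIV f"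

lemma open_avoiding:
  fixes v :: 'a
  assumes "v \<noteq> 0"
  obtains U where "open U" "0 \<in> U" "v \<notin> U"
proof -
  obtain d where d: "Metric_space (UNIV :: 'a set) d" "Metric_space.mtopology UNIV d = euclidean"
    using complete_invariant_metric by blast
  have "Hausdorff_space (euclidean :: 'a topology)"
    using Metric_space.Hausdorff_space_mtopology[OF d(1)] unfolding d(2) .
  then obtain U W where "openin euclidean U" "openin euclidean W" "0 \<in> U" "v \<in> W" "disjnt U W"
    using assms unfolding Hausdorff_space_def topspace_euclidean by (metis UNIV_I)
  then show ?thesis by (intro that[of U]) (auto simp: disjnt_iff)
qed

lemma exists_real_functional:
  assumes "v \<noteq> 0"
  obtains f :: "'a \<Rightarrow> real" where "\<And>x y. f (x + y) = f x + f y"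
    "\<And>t x. f (smul (of_real t) x) = t * f x" "continuous_on UNIV f" "f v \<noteq> 0"
proof -
  interpret R: real_vector_space "\<lambda>t. smul (of_real t)" by (rule real_scaling)
  obtain U where U: "open U" "0 \<in> U" "v \<notin> U" using open_avoiding[OF assms] by blast
  then obtain V where V: "open V" "0 \<in> V" "v \<notin> V"
    and conv: "\<And>x y t. x \<in> V \<Longrightarrow> y \<in> V \<Longrightarrow> 0 \<le> t \<Longrightarrow> t \<le> 1 \<Longrightarrow>
      smul (of_real (1 - t)) x + smul (of_real t) y \<in> V"
    using locally_convex[OF U(1,2)] by (metis atLeastAtMost_iff subsetD)
  have absorb: "\<exists>t>0. smul (of_real (inverse t)) x \<in> V" for x
  proof -
    have "open ((\<lambda>c. smul c x) -` V)"
      by (intro open_vimage V(1) continuous_intros)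
    moreover have "0 \<in> (\<lambda>c. smul c x) -` V" using V(2) by simp
    ultimately obtain e where e: "e > 0" "ball 0 e \<subseteq> (\<lambda>c. smul c x) -` V"
      by (meson open_contains_ball)
    have "(of_real (inverse (2 / e)) :: 'k) \<in> ball 0 e"
      using e(1) by (simp add: norm_divide)
    then have "smul (of_real (inverse (2 / e))) x \<in> V" using e(2) by blast
    with e(1) show ?thesis by (intro exI[of _ "2 / e"]) simp
  qed
  obtain p where p: "R.sublinear p" "\<And>x. x \<in> V \<Longrightarrow> p x \<le> 1" "\<And>x. x \<notin> V \<Longrightarrow> 1 \<le> p x"
    using R.exists_minkowski_functional[of V] absorb conv V(2) by blast
  obtain f where f: "\<And>x y. f (x + y) = f x + f y" "\<And>t x. f (smul (of_real t) x) = t * f x"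
    "\<And>x. f x \<le> p x" "f v = p v"
    using R.hahn_banach_sublinear[OF p(1), of v] by blast
  have diff: "f (x - y) = f x - f y" for x y
    using f(1)[of "x - y" y] by simp
  have "continuous_on UNIV f"
    unfolding continuous_on_topological
  proof (intro ballI allI impI)
    fix x B assume "open B" "f x \<in> B"
    then obtain e where e: "e > 0" "ball (f x) e \<subseteq> B" by (meson open_contains_ball)
    let ?g = "\<lambda>c y. smul (of_real c) (y - x)"
    \<comment> \<open>\<open>f\<close> is at most 1 on \<open>V\<close>; both signs are taken because \<open>V\<close> need not be symmetric\<close>
    define W where "W = ?g (2 / e) -` V \<inter> ?g (- (2 / e)) -` V"
    have "open W" unfolding W_def
      by (intro open_Int open_vimage V(1) continuous_intros)
    moreover have "x \<in> W" using V(2) by (simp add: W_def)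
    moreover have "f y \<in> B" if "y \<in> W" for y
    proof -
      have "f (?g (2 / e) y) \<le> 1" "f (?g (- (2 / e)) y) \<le> 1"
        using that p(2) f(3) unfolding W_def by (auto intro: order_trans)
      then have "\<bar>f y - f x\<bar> * 2 \<le> e"
        unfolding f(2) diff using e(1) by (simp add: field_simps abs_if)
      then have "f y \<in> ball (f x) e" using e(1) by (simp add: dist_real_def abs_minus_commute)
      then show ?thesis using e(2) by blast
    qed
    ultimately show "\<exists>A. open A \<and> x \<in> A \<and> (\<forall>y\<in>UNIV. y \<in> A \<longrightarrow> f y \<in> B)" by blast
  qed
  moreover have "f v \<noteq> 0" using f(4) p(3)[OF V(3)] by simp
  ultimately show ?thesis using that f(1,2) by blast
qed

lemma exists_functional:
  assumes "v \<noteq> 0"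
  obtains f where "functional f" "f v = 1"
proof -
  obtain g :: "'a \<Rightarrow> real" where g: "\<And>x y. g (x + y) = g x + g y"
    "\<And>t x. g (smul (of_real t) x) = t * g x" "continuous_on UNIV g" "g v \<noteq> 0"
    using exists_real_functional[OF assms] by blast
  have "\<exists>f. functional f \<and> f v \<noteq> 0"
    using real_or_complex[where 'a = 'k]
  proof
    assume real: "\<forall>c::'k. \<exists>a. c = a *\<^sub>R 1"
    have "of_real (g (smul c x)) = c * of_real (g x)" for c x
    proof -
      obtain a where "c = of_real a" using real by (metis of_real_def)
      then show ?thesis by (simp add: g(2))
    qed
    then have "functional (\<lambda>x. of_real (g x))"
      by (auto simp: functional_def g(1) intro!: continuous_intros g(3))
    then show ?thesis using g(4) by (intro exI[of _ "\<lambda>x. of_real (g x)"]) auto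
  next
    assume "\<exists>j::'k. j * j = - 1 \<and> (\<forall>c. \<exists>a b. c = a *\<^sub>R 1 + b *\<^sub>R j)"
    then obtain j :: 'k where j: "j * j = - 1" and cx: "\<And>c. \<exists>a b. c = a *\<^sub>R 1 + b *\<^sub>R j"
      by blast
    \<comment> \<open>the complex functional whose real part is \<open>g\<close>\<close>
    define f where "f x = of_real (g x) - j * of_real (g (smul j x))" for x
    have add: "f (x + y) = f x + f y" for x y
      by (simp add: f_def g(1) scale_right_distrib algebra_simps)
    have real: "f (smul (of_real t) x) = of_real t * f x" for t x
    proof -
      have "g (smul j (smul (of_real t) x)) = t * g (smul j x)"
        using g(2)[of t "smul j x"] by (simp add: mult.commute)
      then show ?thesis by (simp add: f_def g(2) algebra_simps)
    qed
    have imag: "f (smul j x) = j * f x" for x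
    proof -
      have "g (smul j (smul j x)) = - g x" using g(2)[of "- 1" x] by (simp add: j)
      then have "f (smul j x) = of_real (g (smul j x)) + j * of_real (g x)"
        by (simp add: f_def)
      also have "\<dots> = j * of_real (g x) - (j * j) * of_real (g (smul j x))"
        by (simp add: j)
      finally show ?thesis by (simp add: f_def algebra_simps)
    qed
    have scale: "f (smul c x) = c * f x" for c x
    proof -
      obtain a b where c: "c = of_real a + of_real b * j"
        using cx[of c] by (metis of_real_def scaleR_conv_of_real mult.right_neutral)
      have "smul c x = smul (of_real a) x + smul (of_real b) (smul j x)"
        by (simp add: c scale_left_distrib)
      then have "f (smul c x) = of_real a * f x + of_real b * (j * f x)"
        by (simp only: add real imag)
      then show ?thesis by (simp add: c distrib_right mult.assoc)
    qed
    have "continuous_on UNIV (\<lambda>x. g (smul j x))"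
      by (rule continuous_on_compose2[OF g(3)]) (auto intro!: continuous_intros)
    then have "continuous_on UNIV f"
      unfolding f_def by (intro continuous_intros g(3))
    with add scale have "functional f" by (simp add: functional_def)
    moreover have "f v \<noteq> 0"
    proof
      assume "f v = 0"
      then have eq: "of_real (g v) = j * of_real (g (smul j v))" by (simp add: f_def)
      have "(of_real (g v * g v) :: 'k) = of_real (g v) * of_real (g v)" by simp
      also have "\<dots> = (j * j) * of_real (g (smul j v) * g (smul j v))"
        unfolding eq by (simp add: algebra_simps)
      also have "\<dots> = of_real (- (g (smul j v) * g (smul j v)))" by (simp add: j)
      finally have "g v * g v = - (g (smul j v) * g (smul j v))"
        by (simp only: of_real_eq_iff)
      then have "g v * g v + g (smul j v) * g (smul j v) = 0" by simp
      then have "g v = 0" by (simp add: sum_squares_eq_zero_iff)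
      with g(4) show False by simp
    qed
    ultimately show ?thesis by blast
  qed
  then obtain f where f: "functional f" "f v \<noteq> 0" by blast
  then have "functional (\<lambda>x. inverse (f v) * f x)"
    by (auto simp: functional_def algebra_simps intro!: continuous_intros)
  then show ?thesis using that[of "\<lambda>x. inverse (f v) * f x"] f(2) by simp
qed

lemma functional_sum:
  assumes "functional f"
  shows "f (\<Sum>i\<in>I. smul (c i) (u i)) = (\<Sum>i\<in>I. c i * f (u i))"
proof -
  have "f 0 = 0"
    using assms unfolding functional_def by (metis add_cancel_right_right)
  then show ?thesis
    using assms by (induction I rule: infinite_finite_induct) (auto simp: functional_def)
qed

lemma functional_diff: "functional f \<Longrightarrow> f (x - y) = f x - f y"
  unfolding functional_def by (metis add_diff_cancel_right' diff_add_cancel)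

lemma functional_lincomb:
  assumes "functional f" "\<And>i. i \<in> I \<Longrightarrow> functional (g i)"
  shows "functional (\<lambda>x. f x - (\<Sum>i\<in>I. c i * g i x))"
  unfolding functional_def
proof (intro conjI allI)
  show "f (x + y) - (\<Sum>i\<in>I. c i * g i (x + y)) =
      f x - (\<Sum>i\<in>I. c i * g i x) + (f y - (\<Sum>i\<in>I. c i * g i y))" for x y
  proof -
    have "(\<Sum>i\<in>I. c i * g i (x + y)) = (\<Sum>i\<in>I. c i * g i x + c i * g i y)"
      using assms(2) by (intro sum.cong) (auto simp: functional_def algebra_simps)
    then show ?thesis using assms(1) by (simp add: functional_def sum.distrib)
  qed
  show "f (smul k x) - (\<Sum>i\<in>I. c i * g i (smul k x)) = k * (f x - (\<Sum>i\<in>I. c i * g i x))" for k x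
  proof -
    have "(\<Sum>i\<in>I. c i * g i (smul k x)) = k * (\<Sum>i\<in>I. c i * g i x)"
      using assms(2) unfolding sum_distrib_left
      by (intro sum.cong) (auto simp: functional_def algebra_simps)
    then show ?thesis using assms(1) by (simp add: functional_def algebra_simps)
  qed
  show "continuous_on UNIV (\<lambda>x. f x - (\<Sum>i\<in>I. c i * g i x))"
    using assms by (intro continuous_intros) (auto simp: functional_def)
qed

lemma exists_dual_functionals:
  assumes "finite B" "independent B"
  shows "\<exists>\<phi>. (\<forall>b\<in>B. functional (\<phi> b)) \<and>
    (\<forall>b\<in>B. \<forall>b'\<in>B. \<phi> b b' = (if b = b' then 1 else 0))"
  using assms
proof (induction B rule: finite_induct)
  case empty
  then show ?case by simp
next
  case (insert a B)
  have aB: "a \<notin> span B" and "independent B"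
    using insert.prems insert.hyps by (auto simp: independent_insert)
  with insert.IH obtain \<phi> where \<phi>: "\<And>b. b \<in> B \<Longrightarrow> functional (\<phi> b)"
    "\<And>b b'. b \<in> B \<Longrightarrow> b' \<in> B \<Longrightarrow> \<phi> b b' = (if b = b' then 1 else 0)" by blast
  \<comment> \<open>the component of \<open>a\<close> that the functionals on \<open>B\<close> do not see\<close>
  define v where "v = a - (\<Sum>b\<in>B. smul (\<phi> b a) b)"
  have "(\<Sum>b\<in>B. smul (\<phi> b a) b) \<in> span B"
    by (intro span_sum span_scale span_base)
  then have "v \<noteq> 0" using aB by (auto simp: v_def)
  then obtain f where f: "functional f" "f v = 1" using exists_functional by blast
  define g where "g x = f x - (\<Sum>b\<in>B. f b * \<phi> b x)" for x
  have g: "functional g" unfolding g_def using f(1) \<phi>(1) by (rule functional_lincomb)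
  have ga: "g a = 1"
    using f(2) unfolding v_def functional_diff[OF f(1)] functional_sum[OF f(1)] g_def
    by (simp add: mult.commute)
  have gB: "g b = 0" if "b \<in> B" for b
  proof -
    have "(\<Sum>b'\<in>B. f b' * \<phi> b' b) = (\<Sum>b'\<in>B. if b' = b then f b' else 0)"
      using that \<phi>(2) by (intro sum.cong) auto
    then show ?thesis using that insert.hyps(1) by (simp add: g_def)
  qed
  \<comment> \<open>subtracting a multiple of \<open>g\<close> makes the old functionals vanish at \<open>a\<close>\<close>
  define \<psi> where "\<psi> b = (if b = a then g else (\<lambda>x. \<phi> b x - \<phi> b a * g x))" for b
  have "functional (\<psi> b)" if "b \<in> insert a B" for b
  proof (cases "b = a")
    case True
    then show ?thesis using g by (simp add: \<psi>_def)
  next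
    case False
    then have "functional (\<phi> b)" using that \<phi>(1) by auto
    from functional_lincomb[OF this, of "{()}" "\<lambda>_. g" "\<lambda>_. \<phi> b a"] g False
    show ?thesis by (simp add: \<psi>_def)
  qed
  moreover have "\<psi> b b' = (if b = b' then 1 else 0)" if "b \<in> insert a B" "b' \<in> insert a B" for b b'
    using that insert.hyps(2) ga gB \<phi>(2) by (auto simp: \<psi>_def)
  ultimately show ?case by blast
qed

section \<open>Operators with prescribed values\<close>

lemma operator_add: "R \<in> operators smul \<Longrightarrow> R (x + y) = R x + R y"
  by (simp add: operators_def Vector_Spaces.linear_iff)

lemma operator_scale: "R \<in> operators smul \<Longrightarrow> R (smul c x) = smul c (R x)"
  by (simp add: operators_def Vector_Spaces.linear_iff)

lemma operator_continuous: "R \<in> operators smul \<Longrightarrow> continuous_on UNIV R"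
  by (simp add: operators_def)

lemma operatorI:
  assumes "\<And>x y. R (x + y) = R x + R y" "\<And>c x. R (smul c x) = smul c (R x)"
    "continuous_on UNIV R"
  shows "R \<in> operators smul"
  using assms vector_space_axioms by (simp add: operators_def Vector_Spaces.linear_iff)

lemma operator_sum:
  assumes "R \<in> operators smul"
  shows "R (\<Sum>i\<in>I. smul (c i) (u i)) = (\<Sum>i\<in>I. smul (c i) (R (u i)))"
proof -
  have "R 0 = 0" using operator_add[OF assms, of 0 0] by simp
  then show ?thesis
    by (induction I rule: infinite_finite_induct)
      (simp_all add: operator_add[OF assms] operator_scale[OF assms])
qed

lemma operator_comp:
  assumes "R \<in> operators smul" "Q \<in> operators smul"
  shows "R \<circ> Q \<in> operators smul"
proof (rule operatorI)
  show "continuous_on UNIV (R \<circ> Q)"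
    using assms by (intro continuous_on_compose continuous_on_subset[OF operator_continuous]) auto
qed (simp_all add: operator_add assms operator_scale)

lemma operator_funpow:
  assumes "R \<in> operators smul"
  shows "R ^^ n \<in> operators smul"
proof (induction n)
  case 0
  then show ?case by (intro operatorI) (auto simp: id_def)
next
  case (Suc n)
  then show ?case using operator_comp[OF assms Suc] by (simp only: funpow.simps)
qed

lemma exists_operator_agreeing:
  assumes B: "finite B" "independent B"
  obtains R where "R \<in> operators smul" "\<And>b. b \<in> B \<Longrightarrow> R b = z b"
proof -
  obtain \<phi> where \<phi>: "\<And>b. b \<in> B \<Longrightarrow> functional (\<phi> b)"
    "\<And>b b'. b \<in> B \<Longrightarrow> b' \<in> B \<Longrightarrow> \<phi> b b' = (if b = b' then 1 else 0)"
    using exists_dual_functionals[OF B] by blast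
  define R where "R x = (\<Sum>b\<in>B. smul (\<phi> b x) (z b))" for x
  have "R \<in> operators smul"
  proof (rule operatorI)
    show "R (x + y) = R x + R y" for x y
      unfolding R_def sum.distrib[symmetric] using \<phi>(1)
      by (intro sum.cong) (auto simp: functional_def scale_left_distrib)
    show "R (smul c x) = smul c (R x)" for c x
      unfolding R_def scale_sum_right using \<phi>(1)
      by (intro sum.cong) (auto simp: functional_def)
    show "continuous_on UNIV R"
      unfolding R_def using \<phi>(1) by (intro continuous_intros) (auto simp: functional_def)
  qed
  moreover have "R b = z b" if "b \<in> B" for b
  proof -
    have "R b = (\<Sum>b'\<in>B. if b' = b then z b' else 0)"
      unfolding R_def using that \<phi>(2) by (intro sum.cong) auto
    then show ?thesis using that B(1) by simp
  qed
  ultimately show ?thesis by (rule that)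
qed

text \<open>A strong-operator neighbourhood, tested on the values at a finite independent set: each
  of the finitely many points that define it is a combination of \<open>B\<close>, so its image depends
  continuously on the values at \<open>B\<close>.\<close>

lemma SOT_neighbourhood:
  assumes A: "openin (SOT smul) A" and S: "S \<in> A"
  obtains F where "finite F"
    "\<And>B. finite B \<Longrightarrow> independent B \<Longrightarrow> F \<subseteq> span B \<Longrightarrow>
      \<exists>G. open G \<and> S \<in> G \<and> (\<forall>R\<in>operators smul. \<forall>z\<in>G. (\<forall>b\<in>B. R b = z b) \<longrightarrow> R \<in> A)"
proof -
  obtain W where W: "openin (product_topology (\<lambda>_. euclidean) UNIV) W"
    and AW: "A = W \<inter> operators smul"
    using A by (auto simp: SOT_def openin_subtopology)
  have SW: "S \<in> W" and Sop: "S \<in> operators smul" using S AW by auto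
  obtain U where fin: "finite {x. U x \<noteq> UNIV}" and U: "\<And>x. open (U x)"
    and SU: "\<And>x. S x \<in> U x" and UW: "Pi\<^sub>E UNIV U \<subseteq> W"
  proof -
    have "\<exists>U. finite {x \<in> UNIV. U x \<noteq> topspace euclidean} \<and> (\<forall>x\<in>UNIV. openin euclidean (U x)) \<and>
        S \<in> Pi\<^sub>E UNIV U \<and> Pi\<^sub>E UNIV U \<subseteq> W"
      using W SW unfolding openin_product_topology_alt by (rule bspec)
    then show ?thesis by (auto simp: PiE_iff intro: that)
  qed
  let ?F = "{x. U x \<noteq> UNIV}"
  show ?thesis
  proof (rule that[OF fin])
    fix B assume B: "finite B" "independent B" "?F \<subseteq> span B"
    let ?E = "\<lambda>z x. \<Sum>b\<in>B. smul (representation B x b) (z b)"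
    have E: "R x = ?E z x"
      if "R \<in> operators smul" "\<forall>b\<in>B. R b = z b" "x \<in> ?F" for R z x
    proof -
      have "x \<in> span B" using B(3) that(3) by blast
      then have x: "(\<Sum>b\<in>B. smul (representation B x b) b) = x"
        using B(1,2) by (intro sum_representation_eq) auto
      have "R x = (\<Sum>b\<in>B. smul (representation B x b) (R b))"
        using operator_sum[OF that(1), of "representation B x" "\<lambda>b. b" B] unfolding x .
      also have "\<dots> = ?E z x" using that(2) by (intro sum.cong) auto
      finally show ?thesis .
    qed
    let ?G = "\<Inter>x\<in>?F. (\<lambda>z. ?E z x) -` U x"
    have cont: "continuous_on UNIV (\<lambda>z. ?E z x)" for x
      by (intro continuous_intros continuous_on_product_coordinates)
    have G: "open ?G"
      using fin U cont by (intro open_INT ballI open_vimage) auto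
    have "?E S x \<in> U x" if "x \<in> ?F" for x
      using SU[of x] E[OF Sop _ that, of S] by simp
    then have SG: "S \<in> ?G" by blast
    have RA: "R \<in> A" if R: "R \<in> operators smul" and z: "z \<in> ?G" and "\<forall>b\<in>B. R b = z b" for R z
    proof -
      have "R x \<in> U x" for x
      proof (cases "x \<in> ?F")
        case True
        then show ?thesis using E[OF R that(3) True] z by auto
      qed auto
      then have "R \<in> W" using UW by auto
      then show ?thesis using R AW by simp
    qed
    show "\<exists>G. open G \<and> S \<in> G \<and>
        (\<forall>R\<in>operators smul. \<forall>z\<in>G. (\<forall>b\<in>B. R b = z b) \<longrightarrow> R \<in> A)"
      using RA by (intro exI[of _ ?G] conjI ballI impI G SG)
  qed
qed

end

section \<open>Transfer between dense limits of iterates\<close>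

lemma continuous_on_funpow:
  fixes f :: "'b::topological_space \<Rightarrow> 'b"
  assumes "continuous_on UNIV f"
  shows "continuous_on UNIV (f ^^ n)"
proof (induction n)
  case 0
  then show ?case by (simp add: id_def)
next
  case (Suc n)
  then show ?case
    using assms unfolding funpow.simps
    by (intro continuous_on_compose continuous_on_subset[OF assms]) auto
qed

text \<open>Nested open sets \<open>O0\<close>, \<open>O1\<close>, \<open>O2\<close> record what is still needed near \<open>y\<close>: that \<open>S\<close> and
  \<open>h\<close> map into \<open>G\<close> and \<open>H\<close>, that one fixed iterate maps into \<open>H\<close>, and that another one maps
  into \<open>G\<close>.  A point of \<open>O2\<close> that returns to \<open>O2\<close> late enough then gives \<open>z\<close>.  The three
  convergence sets are never used at a common point, so they need not intersect.\<close>

lemma dense_limits_transfer: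
  fixes T S h :: "'b::topological_space \<Rightarrow> 'b"
  assumes cont: "continuous_on UNIV T" "continuous_on UNIV S" "continuous_on UNIV h"
    and \<omega>: "closure {x. (\<lambda>n. (T ^^ \<omega> n) x) \<longlonglongrightarrow> S x} = UNIV"
    and \<nu>: "closure {x. (\<lambda>n. (T ^^ \<nu> n) x) \<longlonglongrightarrow> h x} = UNIV"
    and \<theta>: "closure {x. (\<lambda>n. (T ^^ \<theta> n) x) \<longlonglongrightarrow> x} = UNIV" "strict_mono \<theta>"
    and G: "open G" "S y \<in> G" and H: "open H" "h y \<in> H"
  obtains z n where "z \<in> G" "1 \<le> n" "(T ^^ n) z \<in> H"
proof -
  have meets: "\<exists>x\<in>O'. x \<in> D" if "closure D = UNIV" "open O'" "x0 \<in> O'" for D O' and x0 :: 'b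
    using that by (metis UNIV_I closure_iff_nhds_not_empty disjoint_iff order_refl)
  note vim = open_vimage continuous_on_funpow[OF cont(1)]
  define O0 where "O0 = S -` G \<inter> h -` H"
  have O0: "open O0" "y \<in> O0"
    using G H cont by (auto simp: O0_def intro!: open_Int open_vimage)
  obtain y1 where y1: "y1 \<in> O0" "(\<lambda>n. (T ^^ \<nu> n) y1) \<longlonglongrightarrow> h y1"
    using meets[OF \<nu> O0] by blast
  then obtain c where c: "(T ^^ \<nu> c) y1 \<in> H"
    using topological_tendstoD[OF y1(2) H(1)] by (auto simp: O0_def eventually_sequentially)
  define O1 where "O1 = O0 \<inter> (T ^^ \<nu> c) -` H"
  have O1: "open O1" "y1 \<in> O1"
    using O0 y1 c H by (auto simp: O1_def intro!: open_Int vim)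
  obtain y2 where y2: "y2 \<in> O1" "(\<lambda>n. (T ^^ \<omega> n) y2) \<longlonglongrightarrow> S y2"
    using meets[OF \<omega> O1] by blast
  then obtain a where a: "(T ^^ \<omega> a) y2 \<in> G"
    using topological_tendstoD[OF y2(2) G(1)]
    by (auto simp: O1_def O0_def eventually_sequentially)
  define O2 where "O2 = O1 \<inter> (T ^^ \<omega> a) -` G"
  have O2: "open O2" "y2 \<in> O2"
    using O1 y2 a G by (auto simp: O2_def intro!: open_Int vim)
  obtain y3 where y3: "y3 \<in> O2" "(\<lambda>n. (T ^^ \<theta> n) y3) \<longlonglongrightarrow> y3"
    using meets[OF \<theta>(1) O2] by blast
  obtain N where N: "\<And>n. n \<ge> N \<Longrightarrow> (T ^^ \<theta> n) y3 \<in> O2"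
    using topological_tendstoD[OF y3(2) O2(1) y3(1)] by (auto simp: eventually_sequentially)
  define m where "m = max N (Suc (\<omega> a))"
  have m: "(T ^^ \<theta> m) y3 \<in> O2" using N by (simp add: m_def)
  have gt: "\<omega> a < \<theta> m" using strict_mono_imp_increasing[OF \<theta>(2), of m] by (simp add: m_def)
  have sum: "\<nu> c + (\<theta> m - \<omega> a) + \<omega> a = \<nu> c + \<theta> m" using gt by simp
  show ?thesis
  proof (rule that)
    show "(T ^^ \<omega> a) y3 \<in> G" using y3(1) by (simp add: O2_def)
    show "1 \<le> \<nu> c + (\<theta> m - \<omega> a)" using gt by simp
    have "(T ^^ (\<nu> c + (\<theta> m - \<omega> a))) ((T ^^ \<omega> a) y3) = (T ^^ \<nu> c) ((T ^^ \<theta> m) y3)"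
      by (metis sum funpow_add comp_apply)
    then show "(T ^^ (\<nu> c + (\<theta> m - \<omega> a))) ((T ^^ \<omega> a) y3) \<in> H"
      using m by (simp add: O2_def O1_def)
  qed
qed

section \<open>Left composition on the space of all functions\<close>

lemma left_mult_funpow:
  fixes T R :: "'b \<Rightarrow> 'b"
  shows "(left_mult T ^^ n) R = (T ^^ n) \<circ> R"
  by (induction n) (auto simp: left_mult_def)

lemma continuous_on_left_mult:
  fixes f :: "'b::topological_space \<Rightarrow> 'b"
  assumes "continuous_on UNIV f"
  shows "continuous_on UNIV (left_mult f)"
proof (rule continuous_on_coordinatewise_then_product)
  fix i :: 'b
  show "continuous_on UNIV (\<lambda>w. left_mult f w i)"
    unfolding left_mult_def comp_def
    by (rule continuous_on_compose2[OF assms]) (auto intro: continuous_on_product_coordinates)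
qed

lemma dense_convergence_left_mult:
  fixes T f :: "'b::topological_space \<Rightarrow> 'b"
  assumes "closure {x. (\<lambda>n. (T ^^ \<omega> n) x) \<longlonglongrightarrow> f x} = UNIV"
  shows "closure {w. (\<lambda>n. (left_mult T ^^ \<omega> n) w) \<longlonglongrightarrow> left_mult f w} = UNIV"
proof -
  let ?D = "{x. (\<lambda>n. (T ^^ \<omega> n) x) \<longlonglongrightarrow> f x}"
  have "closure (Pi\<^sub>E UNIV (\<lambda>_. ?D)) = (UNIV :: ('b \<Rightarrow> 'b) set)"
    using closure_of_product_topology[of "\<lambda>_. euclidean" "UNIV :: 'b set" "\<lambda>_. ?D"] assms
    by (simp add: euclidean_product_topology)
  moreover have "Pi\<^sub>E UNIV (\<lambda>_. ?D) \<subseteq>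
      {w. (\<lambda>n. (left_mult T ^^ \<omega> n) w) \<longlonglongrightarrow> left_mult f w}"
  proof (rule subsetI, rule CollectI)
    fix w :: "'b \<Rightarrow> 'b"
    assume "w \<in> Pi\<^sub>E UNIV (\<lambda>_. ?D)"
    then have "(\<lambda>n. (T ^^ \<omega> n) (w x)) \<longlonglongrightarrow> f (w x)" for x
      by (auto simp: PiE_iff)
    then have "limitin (product_topology (\<lambda>_. euclidean) UNIV)
        (\<lambda>n. (left_mult T ^^ \<omega> n) w) (left_mult f w) sequentially"
      unfolding limitin_componentwise by (simp add: left_mult_funpow) (simp add: left_mult_def)
    then show "(\<lambda>n. (left_mult T ^^ \<omega> n) w) \<longlonglongrightarrow> left_mult f w"
      unfolding euclidean_product_topology limitin_canonical_iff .
  qed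
  then have "closure (Pi\<^sub>E UNIV (\<lambda>_. ?D)) \<subseteq>
      closure {w. (\<lambda>n. (left_mult T ^^ \<omega> n) w) \<longlonglongrightarrow> left_mult f w}"
    by (rule closure_mono)
  ultimately show ?thesis by blast
qed

section \<open>Orbits of strongly open sets\<close>

theorem theorem3p24:
  fixes smul :: "'k::real_or_complex_field \<Rightarrow> 'a::topological_ab_group_add \<Rightarrow> 'a"
    and T :: "'a \<Rightarrow> 'a"
    and A :: "('a \<Rightarrow> 'a) set"
  assumes "frechet_space smul"
    and "separable_space (euclidean :: 'a topology)"
    and "T \<in> operators smul"
    and "quasi_rigid T"
    and "openin (SOT smul) A"
    and "\<exists>S\<in>A. surj S \<and> S \<in> Omega smul T"
  shows "Omega smul T \<subseteq> SOT smul closure_of (\<Union>n\<in>{1..}. (left_mult T ^^ n) ` A)"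
proof
  interpret frechet_space smul by fact
  note T = \<open>T \<in> operators smul\<close>
  fix h assume "h \<in> Omega smul T"
  then obtain \<nu> :: "nat \<Rightarrow> nat" where hop: "h \<in> operators smul"
    and \<nu>: "closure {x. (\<lambda>n. (T ^^ \<nu> n) x) \<longlonglongrightarrow> h x} = UNIV"
    by (auto simp: Omega_def)
  obtain S and \<omega> :: "nat \<Rightarrow> nat" where SA: "S \<in> A" and Sop: "S \<in> operators smul"
    and \<omega>: "closure {x. (\<lambda>n. (T ^^ \<omega> n) x) \<longlonglongrightarrow> S x} = UNIV"
    using assms(6) by (auto simp: Omega_def)
  obtain \<theta> :: "nat \<Rightarrow> nat" where \<theta>: "strict_mono \<theta>" "closure {x. (\<lambda>n. (T ^^ \<theta> n) x) \<longlonglongrightarrow> x} = UNIV"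
    using assms(4) by (auto simp: quasi_rigid_def)
  have \<theta>': "closure {w. (\<lambda>n. (left_mult T ^^ \<theta> n) w) \<longlonglongrightarrow> w} = UNIV"
    using dense_convergence_left_mult[where T = T and \<omega> = \<theta> and f = id] \<theta>(2) by (simp add: left_mult_def)
  have "\<exists>Q. Q \<in> (\<Union>n\<in>{1..}. (left_mult T ^^ n) ` A) \<and> Q \<in> N"
    if N: "openin (SOT smul) N" "h \<in> N" for N
  proof -
    obtain F where F: "finite F" "\<And>B. finite B \<Longrightarrow> independent B \<Longrightarrow> F \<subseteq> span B \<Longrightarrow>
      \<exists>G. open G \<and> S \<in> G \<and> (\<forall>R\<in>operators smul. \<forall>z\<in>G. (\<forall>b\<in>B. R b = z b) \<longrightarrow> R \<in> A)"
      using SOT_neighbourhood[OF assms(5) SA] by metis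
    obtain F' where F': "finite F'" "\<And>B. finite B \<Longrightarrow> independent B \<Longrightarrow> F' \<subseteq> span B \<Longrightarrow>
      \<exists>G. open G \<and> h \<in> G \<and> (\<forall>R\<in>operators smul. \<forall>z\<in>G. (\<forall>b\<in>B. R b = z b) \<longrightarrow> R \<in> N)"
      using SOT_neighbourhood[OF N] by metis
    obtain B where B: "B \<subseteq> F \<union> F'" "independent B" "F \<union> F' \<subseteq> span B"
      using maximal_independent_subset[of "F \<union> F'"] by blast
    have finB: "finite B" using B(1) F(1) F'(1) by (meson finite_UnI finite_subset)
    obtain G where G: "open G" "S \<in> G"
      "\<And>R z. R \<in> operators smul \<Longrightarrow> z \<in> G \<Longrightarrow> \<forall>b\<in>B. R b = z b \<Longrightarrow> R \<in> A"
      using F(2)[OF finB B(2)] B(3) by (metis le_sup_iff)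
    obtain H where H: "open H" "h \<in> H"
      "\<And>R z. R \<in> operators smul \<Longrightarrow> z \<in> H \<Longrightarrow> \<forall>b\<in>B. R b = z b \<Longrightarrow> R \<in> N"
      using F'(2)[OF finB B(2)] B(3) by (metis le_sup_iff)
    \<comment> \<open>at the identity function, left composition by \<open>S\<close> and by \<open>h\<close> takes the values \<open>S\<close> and \<open>h\<close>\<close>
    have "left_mult S id \<in> G" "left_mult h id \<in> H" using G(2) H(2) by (simp_all add: left_mult_def)
    then obtain z n where z: "z \<in> G" "1 \<le> n" "(left_mult T ^^ n) z \<in> H"
      using dense_limits_transfer[OF
          continuous_on_left_mult[OF operator_continuous[OF T]]
          continuous_on_left_mult[OF operator_continuous[OF Sop]]
          continuous_on_left_mult[OF operator_continuous[OF hop]]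
          dense_convergence_left_mult[OF \<omega>] dense_convergence_left_mult[OF \<nu>] \<theta>' \<theta>(1)
          G(1) _ H(1)]
      by blast
    obtain R where R: "R \<in> operators smul" "\<And>b. b \<in> B \<Longrightarrow> R b = z b"
      using exists_operator_agreeing[OF finB B(2)] by blast
    have "R \<in> A" using G(3)[OF R(1) z(1)] R(2) by blast
    moreover have "(left_mult T ^^ n) R \<in> N"
      using H(3)[OF operator_comp[OF operator_funpow[OF T] R(1)] z(3)] R(2)
      by (simp add: left_mult_funpow)
    ultimately show ?thesis using z(2) by auto
  qed
  then show "h \<in> SOT smul closure_of (\<Union>n\<in>{1..}. (left_mult T ^^ n) ` A)"
    using hop by (auto simp: in_closure_of SOT_def)
qed

end
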